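(* Let $\tau_3(n)$ be the number of standard Young tableaux with $n$ cells and at most three columns. For integers $n\ge0$, $i\ge0$ let $\beta_{n,i}$ be the number of standard Young tableaux with $n$ cells whose shape is $(n-i-2k,\,i+k,\,k)$ for some integer $k\ge0$, and let $r_{n,i}$ be the number of standard Young tableaux of shape $\left(\frac{n+i-2}{3},\frac{n+i-2}{3},\frac{n-2i+1}{3}\right)$ if $n-2i\equiv 2\pmod 3$ and $r_{n,i}=0$ otherwise. Put $R(n)=\sum_{i=0}^{\lfloor n/2\rfloor} r_{n,i}$. Then for every $n\ge 3$, $$\tau_3(n)=3\tau_3(n-1)-R(n)-E(n-1)\,C_{\frac{n-1}{2}}-\beta_{n-1,0},$$ where $C_m=\frac{1}{m+1}\binom{2m}{m}$ is the $m$-th Catalan number and $E(m)=1$ if $m$ is even, $E(m)=0$ otherwise.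
   Context: The shape of a standard Young tableau is written as the list of its column lengths $(c_1,c_2,c_3)$ with $c_1\ge c_2\ge c_3\ge 0$ (zero entries meaning absent columns). The number of standard Young tableaux of a list that is not a valid (weakly decreasing, nonnegative) shape is taken to be $0$. *)

theory Defs
  imports Complex_Main "HOL-Number_Theory.Cong"
begin

text \<open>
  Shapes are lists of column lengths. Entries are integers, so that expressions such as
  \<open>n - i - 2k\<close> may be negative; such lists are not valid shapes. Zero entries are absent columns.
\<close>

definition valid_shape :: "int list \<Rightarrow> bool" where
  "valid_shape c \<longleftrightarrow> sorted_wrt (\<ge>) c \<and> (\<forall>x \<in> set c. 0 \<le> x)"

text \<open>A cell is a pair (row, column), both counted from 0.\<close>

definition diagram :: "int list \<Rightarrow> (nat \<times> nat) set" where
  "diagram c = {(i, j). j < length c \<and> int i < c ! j}"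

text \<open>
  A tableau is a partial function whose domain is its set of cells, so tableaux of
  different diagrams are different objects, and trailing zeros in the shape are irrelevant.
\<close>

definition syt :: "int list \<Rightarrow> (nat \<times> nat \<rightharpoonup> nat) set" where
  "syt c = {T. valid_shape c \<and> dom T = diagram c \<and>
     inj_on T (dom T) \<and> ran T = {1..card (dom T)} \<and>
     (\<forall>i j j'. (i, j) \<in> dom T \<and> (i, j') \<in> dom T \<and> j < j' \<longrightarrow> the (T (i, j)) < the (T (i, j'))) \<and>
     (\<forall>i i' j. (i, j) \<in> dom T \<and> (i', j) \<in> dom T \<and> i < i' \<longrightarrow> the (T (i, j)) < the (T (i', j)))}"

definition tau3 :: "nat \<Rightarrow> nat" where
  "tau3 n = card {T. card (dom T) = n \<and> (\<exists>c. length c \<le> 3 \<and> T \<in> syt c)}"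

definition beta :: "nat \<Rightarrow> nat \<Rightarrow> nat" where
  "beta n i = card {T. card (dom T) = n \<and>
     (\<exists>k::nat. T \<in> syt [int n - int i - 2 * int k, int i + int k, int k])}"

definition r_num :: "nat \<Rightarrow> nat \<Rightarrow> nat" where
  "r_num n i = (if [int n - 2 * int i = 2] (mod 3)
     then card (syt [(int n + int i - 2) div 3, (int n + int i - 2) div 3, (int n - 2 * int i + 1) div 3])
     else 0)"

definition R_sum :: "nat \<Rightarrow> nat" where
  "R_sum n = (\<Sum>i = 0..n div 2. r_num n i)"

definition catalan :: "nat \<Rightarrow> real" where
  "catalan m = 1 / (real m + 1) * real ((2 * m) choose m)"

definition even_ind :: "nat \<Rightarrow> real" where
  "even_ind m = (if even m then 1 else 0)"

end

theory Submission
  imports Defs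
begin

text \<open>
  Deleting the largest entry of a tableau leaves a tableau with one cell less, so the tableaux with
  \<open>n\<close> cells and at most three columns correspond to pairs of such a tableau with \<open>n - 1\<close> cells and
  a column to which a cell can be added. The first column can always be extended, the
  second one unless the shape is \<open>(a, a, c)\<close>, and the third one unless it is \<open>(a, b, b)\<close>. The
  shapes \<open>(a, b, b)\<close> are counted by \<open>\<beta>\<close>, the shapes \<open>(a, a, c)\<close> with \<open>c > 0\<close> by \<open>R\<close>, and
  \<open>(a, a, 0)\<close> by a Catalan number.
\<close>

section \<open>Diagrams and elementary facts about tableaux\<close>

text \<open>For an empty column \<open>nat\<close> truncates to row 0, so the value is then
  \<open>(0, j)\<close>, which lies outside the diagram.\<close>

definition col_end :: "int list \<Rightarrow> nat \<Rightarrow> nat \<times> nat" where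
  "col_end c j = (nat (c ! j - 1), j)"

lemma diagram_eq_Sigma: "diagram c = (\<lambda>(j, i). (i, j)) ` (SIGMA j:{..<length c}. {..<nat (c ! j)})"
  by (force simp: diagram_def zless_nat_eq_int_zless)

lemma finite_diagram: "finite (diagram c)"
  unfolding diagram_eq_Sigma by (intro finite_imageI finite_SigmaI) auto

lemma card_diagram:
  assumes "\<forall>x \<in> set c. 0 \<le> x"
  shows "int (card (diagram c)) = sum_list c"
proof -
  have "card (diagram c) = card (SIGMA j:{..<length c}. {..<nat (c ! j)})"
    unfolding diagram_eq_Sigma by (intro card_image) (auto simp: inj_on_def)
  also have "\<dots> = (\<Sum>j<length c. nat (c ! j))"
    by simp
  also have "int \<dots> = (\<Sum>j<length c. c ! j)"
    using assms by (simp add: of_nat_sum)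
  finally show ?thesis
    by (simp add: sum_list_sum_nth lessThan_atLeast0)
qed

lemma finite_syt: "finite (syt c)"
proof -
  have "syt c \<subseteq> {T. dom T = diagram c \<and> ran T \<subseteq> {1..card (diagram c)}}"
    by (auto simp: syt_def)
  then show ?thesis
    by (rule finite_subset) (rule finite_set_of_finite_maps, auto simp: finite_diagram)
qed

lemma syt_invalid: "\<not> valid_shape c \<Longrightarrow> syt c = {}"
  by (simp add: syt_def)

lemma valid_shape_nth_mono:
  assumes "valid_shape c" "j \<le> k" "k < length c"
  shows "c ! k \<le> c ! j"
  using assms by (cases "j = k") (auto simp: valid_shape_def sorted_wrt_iff_nth_less)

lemma valid_shape_nth_nonneg: "valid_shape c \<Longrightarrow> j < length c \<Longrightarrow> 0 \<le> c ! j"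
  by (auto simp: valid_shape_def)

lemma diagram_decr:
  assumes "j < length c" "0 < c ! j"
  shows "diagram (c[j := c ! j - 1]) = diagram c - {col_end c j}" "col_end c j \<in> diagram c"
  using assms by (auto simp: diagram_def col_end_def nth_list_update split: if_splits)

lemma sytD:
  assumes "T \<in> syt c"
  shows "valid_shape c" "dom T = diagram c" "inj_on T (dom T)" "ran T = {1..card (diagram c)}"
    "\<And>i j j'. (i, j) \<in> diagram c \<Longrightarrow> (i, j') \<in> diagram c \<Longrightarrow> j < j' \<Longrightarrow> the (T (i, j)) < the (T (i, j'))"
    "\<And>i i' j. (i, j) \<in> diagram c \<Longrightarrow> (i', j) \<in> diagram c \<Longrightarrow> i < i' \<Longrightarrow> the (T (i, j)) < the (T (i', j))"
  using assms by (auto simp: syt_def)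

lemma sytI:
  assumes "valid_shape c" "dom T = diagram c" "inj_on T (diagram c)" "ran T = {1..card (diagram c)}"
    "\<And>i j j'. (i, j) \<in> diagram c \<Longrightarrow> (i, j') \<in> diagram c \<Longrightarrow> j < j' \<Longrightarrow> the (T (i, j)) < the (T (i, j'))"
    "\<And>i i' j. (i, j) \<in> diagram c \<Longrightarrow> (i', j) \<in> diagram c \<Longrightarrow> i < i' \<Longrightarrow> the (T (i, j)) < the (T (i', j))"
  shows "T \<in> syt c"
  using assms by (auto simp: syt_def)

lemma syt_entry_le:
  assumes "T \<in> syt c" "x \<in> diagram c"
  shows "the (T x) \<le> card (diagram c)"
proof -
  obtain y where y: "T x = Some y"
    using sytD(2)[OF assms(1)] assms(2) by blast
  then have "y \<in> ran T" by (rule ranI)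
  then show ?thesis using y sytD(4)[OF assms(1)] by simp
qed

section \<open>The branching rule: removing the largest entry\<close>

definition syt_max_in :: "int list \<Rightarrow> nat \<Rightarrow> (nat \<times> nat \<rightharpoonup> nat) set" where
  "syt_max_in c j = {T \<in> syt c. col_end c j \<in> diagram c \<and> T (col_end c j) = Some (card (diagram c))}"

text \<open>Entries increase down each column, so a cell below the one with the largest entry would
  carry a still larger entry; the maximum therefore sits at the bottom of some column.\<close>

lemma syt_eq_UN_max:
  assumes "diagram c \<noteq> {}"
  shows "syt c = (\<Union>j<length c. syt_max_in c j)"
proof (intro equalityI subsetI)
  fix T assume T: "T \<in> syt c"
  let ?m = "card (diagram c)"
  have "?m \<in> ran T"
    using assms sytD(4)[OF T] finite_diagram[of c] by (simp add: Suc_le_eq card_gt_0_iff)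
  then obtain i j where ij: "T (i, j) = Some ?m"
    by (auto simp: ran_def)
  then have mem: "(i, j) \<in> diagram c"
    using sytD(2)[OF T] by blast
  then have j: "j < length c" and ic: "int i < c ! j"
    by (auto simp: diagram_def)
  have "i = nat (c ! j - 1)"
  proof (rule ccontr)
    assume "i \<noteq> nat (c ! j - 1)"
    then have "(Suc i, j) \<in> diagram c"
      using j ic by (auto simp: diagram_def)
    from sytD(6)[OF T mem this] syt_entry_le[OF T this] ij show False
      by simp
  qed
  then have "T \<in> syt_max_in c j"
    using T ij mem by (simp add: syt_max_in_def col_end_def)
  with j show "T \<in> (\<Union>j<length c. syt_max_in c j)" by blast
qed (auto simp: syt_max_in_def)

text \<open>By injectivity the maximum occupies a single cell, whereas the ends of different columns
  differ in their second coordinate.\<close>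

lemma syt_max_in_disjoint:
  assumes "j \<noteq> k"
  shows "syt_max_in c j \<inter> syt_max_in c k = {}"
proof -
  have False if "T \<in> syt_max_in c j" "T \<in> syt_max_in c k" for T
  proof -
    have "inj_on T (diagram c)"
      using that sytD(2,3)[of T c] by (simp add: syt_max_in_def)
    then have "col_end c j = col_end c k"
      using that by (auto simp: syt_max_in_def elim: inj_onD)
    with assms show False by (simp add: col_end_def)
  qed
  then show ?thesis by blast
qed

text \<open>Erasing the maximum from the end of column \<open>j\<close> is inverted by writing it
  back. If shortening column \<open>j\<close> destroys the shape, both sides are 0: either the
  column is empty, or a later column is equally long and blocks the maximum.\<close>

lemma card_syt_max_in:
  assumes c: "valid_shape c" and j: "j < length c"
  shows "card (syt_max_in c j) = card (syt (c[j := c ! j - 1]))"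
proof (cases "0 < c ! j")
  case False
  then have "c ! j = 0"
    using valid_shape_nth_nonneg[OF c j] by simp
  then have "\<not> valid_shape (c[j := c ! j - 1])"
    using j valid_shape_nth_nonneg[of "c[j := c ! j - 1]" j] by auto
  moreover have "syt_max_in c j = {}"
    using False by (auto simp: syt_max_in_def col_end_def diagram_def)
  ultimately show ?thesis by (simp add: syt_invalid)
next
  case pos: True
  define d where "d = c[j := c ! j - 1]"
  define x where "x = col_end c j"
  define m where "m = card (diagram c)"
  have dd: "diagram d = diagram c - {x}" and x: "x \<in> diagram c"
    unfolding d_def x_def using diagram_decr[OF j pos] by auto
  have m: "card (diagram d) = m - 1" "0 < m"
    using x finite_diagram[of c] by (auto simp: dd m_def card_gt_0_iff)
  have ran_m: "{1..m} = insert m {1..m - 1}" using m(2) by auto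
  show ?thesis
  proof (cases "valid_shape d")
    case False
    have "syt_max_in c j = {}"
    proof (rule ccontr)
      assume "syt_max_in c j \<noteq> {}"
      then obtain T where T: "T \<in> syt c" "T x = Some m"
        by (auto simp: syt_max_in_def x_def m_def)
      \<comment> \<open>A later column of the same length would have a cell to the right of
        \<open>x\<close> in its row, with an entry above the maximum.\<close>
      have less: "c ! k < c ! j" if "j < k" "k < length c" for k
      proof (rule ccontr)
        assume "\<not> c ! k < c ! j"
        then have mem: "(nat (c ! j - 1), k) \<in> diagram c"
          using that pos by (auto simp: diagram_def)
        from sytD(5)[OF T(1) x[unfolded x_def col_end_def] mem that(1)] syt_entry_le[OF T(1) mem] T(2)
        show False by (simp add: x_def col_end_def m_def)
      qed
      have "valid_shape d"
        unfolding valid_shape_def sorted_wrt_iff_nth_less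
      proof (intro conjI allI impI ballI)
        fix p q assume pq: "p < q" "q < length d"
        have "c ! q \<le> c ! p"
          using valid_shape_nth_mono[OF c, of p q] pq by (simp add: d_def)
        then show "d ! q \<le> d ! p"
          using less[of q] pq j by (auto simp: d_def nth_list_update)
      next
        fix y assume "y \<in> set d"
        then obtain q where "q < length d" "y = d ! q"
          by (auto simp: in_set_conv_nth)
        then show "0 \<le> y"
          using valid_shape_nth_nonneg[OF c, of q] pos j by (auto simp: d_def nth_list_update)
      qed
      with False show False by simp
    qed
    with False show ?thesis by (simp add: syt_invalid flip: d_def)
  next
    case d: True
    have "bij_betw (\<lambda>T. T(x := None)) (syt_max_in c j) (syt d)"
    proof (rule bij_betw_byWitness[where f' = "\<lambda>T. T(x \<mapsto> m)"])
      show "\<forall>T\<in>syt_max_in c j. T(x := None, x \<mapsto> m) = T"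
        by (auto simp: syt_max_in_def x_def m_def)
      show "\<forall>T\<in>syt d. T(x \<mapsto> m, x := None) = T"
      proof
        fix T assume "T \<in> syt d"
        then have "x \<notin> dom T" using dd by (auto dest: sytD(2))
        then show "T(x \<mapsto> m, x := None) = T" by auto
      qed
      show "(\<lambda>T. T(x := None)) ` syt_max_in c j \<subseteq> syt d"
      proof (rule image_subsetI)
        fix T assume "T \<in> syt_max_in c j"
        then have T: "T \<in> syt c" and Tx: "T x = Some m"
          by (auto simp: syt_max_in_def x_def m_def)
        show "T(x := None) \<in> syt d"
        proof (rule sytI)
          show "dom (T(x := None)) = diagram d"
            using sytD(2)[OF T] dd by simp
          have inj: "inj_on T (diagram c)"
            using sytD(2,3)[OF T] by simp
          then show "inj_on (T(x := None)) (diagram d)"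
            by (auto simp: dd inj_on_def)
          have "y \<noteq> m" if "T z = Some y" "z \<noteq> x" for y z
            using that Tx inj x sytD(2)[OF T] by (metis domI inj_onD)
          then have "ran (T(x := None)) = ran T - {m}"
            using Tx by (force simp: ran_def)
          then show "ran (T(x := None)) = {1..card (diagram d)}"
            using sytD(4)[OF T, folded m_def] m(2) unfolding m(1) ran_m by fastforce
        next
          fix i k k' assume "(i, k) \<in> diagram d" "(i, k') \<in> diagram d" "k < k'"
          then show "the ((T(x := None)) (i, k)) < the ((T(x := None)) (i, k'))"
            using sytD(5)[OF T, of i k k'] by (simp add: dd)
        next
          fix i i' k assume "(i, k) \<in> diagram d" "(i', k) \<in> diagram d" "i < i'"
          then show "the ((T(x := None)) (i, k)) < the ((T(x := None)) (i', k))"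
            using sytD(6)[OF T, of i k i'] by (simp add: dd)
        qed (fact d)
      qed
      show "(\<lambda>T. T(x \<mapsto> m)) ` syt d \<subseteq> syt_max_in c j"
      proof (rule image_subsetI)
        fix T assume T: "T \<in> syt d"
        have dc: "diagram c = insert x (diagram d)" and xd: "x \<notin> diagram d"
          using x dd by auto
        have dT: "dom T = diagram d" by (rule sytD(2)[OF T])
        have le: "the (T y) < m" if "y \<in> diagram d" for y
          using syt_entry_le[OF T that] m by simp
        have neq: "T y \<noteq> Some m" for y
          using le[of y] dT by force
        \<comment> \<open>\<open>x\<close> is a corner of the larger diagram: no cell of
          \<open>d\<close> lies below it or to its right. Hence the new maximum \<open>m\<close> at
          \<open>x\<close> never has to be smaller than another entry.\<close>
        have last_i: "i < nat (c ! j - 1)" if "(i, j) \<in> diagram d" for i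
          using that j by (simp add: diagram_def d_def)
        have last_j: "k < j" if "(nat (c ! j - 1), k) \<in> diagram d" for k
        proof (rule ccontr)
          assume "\<not> k < j"
          with valid_shape_nth_mono[OF d, of j k] that j pos show False
            by (auto simp: diagram_def d_def)
        qed
        have "T(x \<mapsto> m) \<in> syt c"
        proof (rule sytI)
          show "dom (T(x \<mapsto> m)) = diagram c"
            using dT dc by simp
          show "inj_on (T(x \<mapsto> m)) (diagram c)"
            using sytD(3)[OF T] xd neq unfolding dc dT
            by (auto simp: inj_on_def) (metis neq)+
          have "ran (T(x \<mapsto> m)) = insert m (ran T)"
            using xd dT by (intro ran_map_upd) auto
          then show "ran (T(x \<mapsto> m)) = {1..card (diagram c)}"
            using sytD(4)[OF T] ran_m by (simp add: m(1) m_def[symmetric])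
        next
          fix i k k' assume *: "(i, k) \<in> diagram c" "(i, k') \<in> diagram c" "k < k'"
          have "(i, k) \<noteq> x"
            using * last_j[of k'] by (auto simp: dc x_def col_end_def)
          with * show "the ((T(x \<mapsto> m)) (i, k)) < the ((T(x \<mapsto> m)) (i, k'))"
            using sytD(5)[OF T, of i k k'] le[of "(i, k)"] by (auto simp: dc)
        next
          fix i i' k assume *: "(i, k) \<in> diagram c" "(i', k) \<in> diagram c" "i < i'"
          have "(i, k) \<noteq> x"
            using * last_i[of i'] by (auto simp: dc x_def col_end_def)
          with * show "the ((T(x \<mapsto> m)) (i, k)) < the ((T(x \<mapsto> m)) (i', k))"
            using sytD(6)[OF T, of i k i'] le[of "(i, k)"] by (auto simp: dc)
        qed (fact c)
        then show "T(x \<mapsto> m) \<in> syt_max_in c j"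
          using x by (simp add: syt_max_in_def x_def m_def)
      qed
    qed
    then show ?thesis
      unfolding d_def by (rule bij_betw_same_card)
  qed
qed

text \<open>All columns may be summed over because those that cannot be shortened contribute 0. The
  empty diagram is excluded: it has one tableau but no largest entry.\<close>

theorem card_syt_branching:
  assumes "valid_shape c" "sum_list c \<noteq> 0"
  shows "card (syt c) = (\<Sum>j<length c. card (syt (c[j := c ! j - 1])))"
proof -
  have "diagram c \<noteq> {}"
    using card_diagram[of c] assms by (auto simp: valid_shape_def)
  then have "card (syt c) = (\<Sum>j<length c. card (syt_max_in c j))"
    unfolding syt_eq_UN_max[OF \<open>diagram c \<noteq> {}\<close>]
    by (intro card_UN_disjoint)
      (auto intro: finite_subset[OF _ finite_syt] simp: syt_max_in_def syt_max_in_disjoint[unfolded syt_max_in_def])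
  also have "\<dots> = (\<Sum>j<length c. card (syt (c[j := c ! j - 1])))"
    using assms by (intro sum.cong) (auto simp: card_syt_max_in)
  finally show ?thesis .
qed

section \<open>Counting tableaux as sums over three-column shapes\<close>

text \<open>Triples instead of lists make it easy to reindex sums by shifting one
  coordinate.\<close>

definition shapes3 :: "nat \<Rightarrow> (int \<times> int \<times> int) set" where
  "shapes3 n = {(a, b, c). 0 \<le> c \<and> c \<le> b \<and> b \<le> a \<and> a + b + c = int n}"

fun num3 :: "int \<times> int \<times> int \<Rightarrow> nat" where
  "num3 (a, b, c) = card (syt [a, b, c])"

lemma finite_shapes3: "finite (shapes3 n)"
  by (rule finite_subset[of _ "{0..int n} \<times> {0..int n} \<times> {0..int n}"]) (auto simp: shapes3_def)

lemma valid_shape3: "valid_shape [a, b, c] \<longleftrightarrow> 0 \<le> c \<and> c \<le> b \<and> b \<le> a"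
  by (auto simp: valid_shape_def)

lemma num3_invalid: "\<not> (0 \<le> c \<and> c \<le> b \<and> b \<le> a) \<Longrightarrow> num3 (a, b, c) = 0"
  by (simp add: syt_invalid valid_shape3)

lemma num3_branching:
  assumes "0 \<le> c" "c \<le> b" "b \<le> a" "a + b + c \<noteq> 0"
  shows "num3 (a, b, c) = num3 (a - 1, b, c) + num3 (a, b - 1, c) + num3 (a, b, c - 1)"
  using card_syt_branching[of "[a, b, c]"] assms
  by (simp add: valid_shape3 eval_nat_numeral lessThan_Suc)

text \<open>Tableaux of different three-column shapes have different domains, so the sets of
  tableaux are disjoint.\<close>

lemma diagram3_inject:
  assumes "diagram [a, b, c] = diagram [a', b', c']" "0 \<le> c" "c \<le> b" "b \<le> a" "0 \<le> c'" "c' \<le> b'" "b' \<le> a'"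
  shows "(a, b, c) = (a', b', c')"
proof -
  \<comment> \<open>Testing the equivalence at the first row beyond each column,
    \<open>nat x\<close> and \<open>nat y\<close>, gives both inequalities.\<close>
  have *: "x = y" if "\<And>i::nat. int i < x \<longleftrightarrow> int i < y" "0 \<le> x" "0 \<le> y" for x y :: int
    using that(1)[of "nat x"] that(1)[of "nat y"] that(2,3) by simp
  have "(i, j) \<in> diagram [a, b, c] \<longleftrightarrow> (i, j) \<in> diagram [a', b', c']" for i j
    using assms(1) by simp
  from this[of _ 0] this[of _ 1] this[of _ 2] show ?thesis
    using assms(2-) by (auto simp: diagram_def intro!: *)
qed

lemma card_UN_syt3:
  assumes "Q \<subseteq> shapes3 n"
  shows "card (\<Union>(a, b, c)\<in>Q. syt [a, b, c]) = sum num3 Q"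
proof -
  have "card (\<Union>p\<in>Q. case p of (a, b, c) \<Rightarrow> syt [a, b, c])
      = (\<Sum>p\<in>Q. card (case p of (a, b, c) \<Rightarrow> syt [a, b, c]))"
  proof (rule card_UN_disjoint)
    show "finite Q" using assms finite_shapes3 by (rule finite_subset)
    show "\<forall>p\<in>Q. finite (case p of (a, b, c) \<Rightarrow> syt [a, b, c])"
      by (auto simp: finite_syt)
    show "\<forall>p\<in>Q. \<forall>q\<in>Q. p \<noteq> q \<longrightarrow>
        (case p of (a, b, c) \<Rightarrow> syt [a, b, c]) \<inter> (case q of (a, b, c) \<Rightarrow> syt [a, b, c]) = {}"
    proof (intro ballI impI)
      fix p q :: "int \<times> int \<times> int" assume "p \<noteq> q"
      obtain a b c a' b' c' where pq: "p = (a, b, c)" "q = (a', b', c')"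
        by (metis prod_cases3)
      have False if "T \<in> syt [a, b, c]" "T \<in> syt [a', b', c']" for T
        using diagram3_inject[of a b c a' b' c'] that[THEN sytD(2)] that[THEN sytD(1)] \<open>p \<noteq> q\<close>
        by (auto simp: valid_shape3 pq)
      then show "(case p of (a, b, c) \<Rightarrow> syt [a, b, c]) \<inter> (case q of (a, b, c) \<Rightarrow> syt [a, b, c]) = {}"
        by (auto simp: pq)
    qed
  qed
  also have "\<dots> = sum num3 Q" by (intro sum.cong) auto
  finally show ?thesis .
qed

lemma syt3_shapes:
  assumes "T \<in> syt [a, b, c]"
  shows "(a, b, c) \<in> shapes3 (card (dom T))"
  using sytD(1,2)[OF assms] card_diagram[of "[a, b, c]"] by (auto simp: valid_shape3 shapes3_def)

lemma card_dom_syt3: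
  assumes "T \<in> syt [a, b, c]" "(a, b, c) \<in> shapes3 n"
  shows "card (dom T) = n"
  using syt3_shapes[OF assms(1)] assms(2) by (simp add: shapes3_def)

lemma syt_append_zero:
  assumes "valid_shape c"
  shows "syt c = syt (c @ [0])"
proof -
  have "valid_shape (c @ [0])"
    using assms by (auto simp: valid_shape_def sorted_wrt_append)
  moreover have "diagram (c @ [0]) = diagram c"
    by (auto simp: diagram_def nth_append split: if_splits)
  ultimately show ?thesis
    using assms by (simp add: syt_def)
qed

text \<open>Zero columns add no cells, so "at most three columns" can be replaced by "exactly three,
  possibly empty".\<close>

lemma syt_pad_length:
  assumes "T \<in> syt c" "length c \<le> m"
  shows "\<exists>d. length d = m \<and> T \<in> syt d"
  using assms(2)
proof (induction m)
  case 0
  then show ?case using assms(1) by auto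
next
  case (Suc m)
  show ?case
  proof (cases "length c = Suc m")
    case False
    with Suc obtain d where d: "length d = m" "T \<in> syt d" by force
    then have "T \<in> syt (d @ [0])"
      using syt_append_zero[of d] sytD(1) by blast
    with d(1) show ?thesis by (intro exI[of _ "d @ [0]"]) simp
  qed (use assms(1) in blast)
qed

lemma tau3_eq_sum: "tau3 n = sum num3 (shapes3 n)"
proof -
  have "{T. card (dom T) = n \<and> (\<exists>c. length c \<le> 3 \<and> T \<in> syt c)}
      = (\<Union>(a, b, c)\<in>shapes3 n. syt [a, b, c])"
  proof (intro equalityI subsetI)
    fix T assume "T \<in> {T. card (dom T) = n \<and> (\<exists>c. length c \<le> 3 \<and> T \<in> syt c)}"
    then obtain d where d: "length d = 3" "T \<in> syt d" and n: "card (dom T) = n"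
      using syt_pad_length by blast
    from d(1) obtain a b c where "d = [a, b, c]"
      by (auto simp: numeral_3_eq_3 length_Suc_conv)
    with d(2) n syt3_shapes[of T a b c] show "T \<in> (\<Union>(a, b, c)\<in>shapes3 n. syt [a, b, c])"
      by auto
  next
    fix T assume "T \<in> (\<Union>(a, b, c)\<in>shapes3 n. syt [a, b, c])"
    then obtain a b c where "(a, b, c) \<in> shapes3 n" "T \<in> syt [a, b, c]" by auto
    then show "T \<in> {T. card (dom T) = n \<and> (\<exists>c. length c \<le> 3 \<and> T \<in> syt c)}"
      using card_dom_syt3 by (auto intro!: exI[of _ "[a, b, c]"])
  qed
  then show ?thesis
    unfolding tau3_def using card_UN_syt3[of "shapes3 n" n] by simp
qed

text \<open>For \<open>i = 0\<close> the shapes are \<open>(n - 2k, k, k)\<close>: exactly those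
  whose third column cannot be extended.\<close>

lemma beta_0_eq_sum: "beta n 0 = (\<Sum>p\<in>{(a, b, c) \<in> shapes3 n. b = c}. num3 p)"
proof -
  let ?Q = "{(a, b, c) \<in> shapes3 n. b = c}"
  have "{T. card (dom T) = n \<and> (\<exists>k::nat. T \<in> syt [int n - int 0 - 2 * int k, int 0 + int k, int k])}
      = (\<Union>(a, b, c)\<in>?Q. syt [a, b, c])"
  proof (intro equalityI subsetI)
    fix T assume "T \<in> {T. card (dom T) = n \<and> (\<exists>k::nat. T \<in> syt [int n - int 0 - 2 * int k, int 0 + int k, int k])}"
    then obtain k :: nat where "T \<in> syt [int n - 2 * int k, int k, int k]" "card (dom T) = n"
      by auto
    with syt3_shapes[OF this(1)] show "T \<in> (\<Union>(a, b, c)\<in>?Q. syt [a, b, c])" by blast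
  next
    fix T assume "T \<in> (\<Union>(a, b, c)\<in>?Q. syt [a, b, c])"
    then obtain a b where ab: "(a, b, b) \<in> shapes3 n" "T \<in> syt [a, b, b]" by auto
    then have "card (dom T) = n" by (auto dest: card_dom_syt3)
    moreover have "a = int n - int 0 - 2 * int (nat b)" "int (nat b) = b"
      using ab(1) by (auto simp: shapes3_def)
    ultimately show "T \<in> {T. card (dom T) = n \<and> (\<exists>k::nat. T \<in> syt [int n - int 0 - 2 * int k, int 0 + int k, int k])}"
      using ab(2) by (auto intro!: exI[of _ "nat b"])
  qed
  then show ?thesis
    unfolding beta_def by (subst card_UN_syt3[symmetric, of _ n]) auto
qed

section \<open>The recurrence for \<open>tau3\<close>\<close>

text \<open>Shortening a column either leaves the set of shapes, and the term vanishes, or reaches a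
  smaller shape in which that column can be extended. This is always possible for the first column,
  and requires strict inequality with the preceding column for the others.\<close>

lemma sum_shapes3_shift:
  "(\<Sum>(a, b, c)\<in>shapes3 (Suc n). num3 (a - 1, b, c)) = sum num3 (shapes3 n)"
  "(\<Sum>(a, b, c)\<in>shapes3 (Suc n). num3 (a, b - 1, c)) = sum num3 {(a, b, c) \<in> shapes3 n. a \<noteq> b}"
  "(\<Sum>(a, b, c)\<in>shapes3 (Suc n). num3 (a, b, c - 1)) = sum num3 {(a, b, c) \<in> shapes3 n. b \<noteq> c}"
proof -
  have fin: "finite {(a, b, c) \<in> shapes3 (Suc n). P a b c}" for P
    by (rule finite_subset[OF _ finite_shapes3[of "Suc n"]]) auto
  show "(\<Sum>(a, b, c)\<in>shapes3 (Suc n). num3 (a - 1, b, c)) = sum num3 (shapes3 n)"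
    \<comment> \<open>\<open>S'\<close> collects the vanishing terms: the shapes whose shortened
      column would be one cell shorter than its right neighbour. In the third sum it is instead the
      shapes with empty third column.\<close>
    by (rule sum.reindex_bij_witness_not_neutral[where S' = "{(a, b, c) \<in> shapes3 (Suc n). a = b}"
          and T' = "{}" and i = "\<lambda>(a, b, c). (a + 1, b, c)" and j = "\<lambda>(a, b, c). (a - 1, b, c)"])
      (use fin in \<open>auto simp: shapes3_def num3_invalid simp del: num3.simps\<close>)
  show "(\<Sum>(a, b, c)\<in>shapes3 (Suc n). num3 (a, b - 1, c)) = sum num3 {(a, b, c) \<in> shapes3 n. a \<noteq> b}"
    by (rule sum.reindex_bij_witness_not_neutral[where S' = "{(a, b, c) \<in> shapes3 (Suc n). b = c}"
          and T' = "{}" and i = "\<lambda>(a, b, c). (a, b + 1, c)" and j = "\<lambda>(a, b, c). (a, b - 1, c)"])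
      (use fin in \<open>auto simp: shapes3_def num3_invalid simp del: num3.simps\<close>)
  show "(\<Sum>(a, b, c)\<in>shapes3 (Suc n). num3 (a, b, c - 1)) = sum num3 {(a, b, c) \<in> shapes3 n. b \<noteq> c}"
    by (rule sum.reindex_bij_witness_not_neutral[where S' = "{(a, b, c) \<in> shapes3 (Suc n). c = 0}"
          and T' = "{}" and i = "\<lambda>(a, b, c). (a, b, c + 1)" and j = "\<lambda>(a, b, c). (a, b, c - 1)"])
      (use fin in \<open>auto simp: shapes3_def num3_invalid simp del: num3.simps\<close>)
qed

lemma sum_shapes3_split:
  "sum num3 {p \<in> shapes3 n. P p} + sum num3 {p \<in> shapes3 n. \<not> P p} = sum num3 (shapes3 n)"
  by (subst sum.union_disjoint[symmetric])
    (auto simp: finite_shapes3 intro: sum.cong)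

text \<open>The excluded shapes are added on the left, which avoids truncated subtraction on
  naturals.\<close>

lemma tau3_Suc:
  "tau3 (Suc n) + sum num3 {(a, b, c) \<in> shapes3 n. a = b} + sum num3 {(a, b, c) \<in> shapes3 n. b = c}
    = 3 * tau3 n"
proof -
  have "tau3 (Suc n) = (\<Sum>(a, b, c)\<in>shapes3 (Suc n).
      num3 (a - 1, b, c) + num3 (a, b - 1, c) + num3 (a, b, c - 1))"
    unfolding tau3_eq_sum
    by (intro sum.cong) (auto simp: shapes3_def num3_branching simp del: num3.simps)
  also have "\<dots> = tau3 n + sum num3 {(a, b, c) \<in> shapes3 n. a \<noteq> b} + sum num3 {(a, b, c) \<in> shapes3 n. b \<noteq> c}"
    unfolding tau3_eq_sum sum_shapes3_shift[symmetric]
    by (simp add: sum.distrib case_prod_unfold del: num3.simps)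
  finally show ?thesis
    using sum_shapes3_split[of n "\<lambda>(a, b, c). a = b"] sum_shapes3_split[of n "\<lambda>(a, b, c). b = c"]
    by (simp add: tau3_eq_sum case_prod_unfold)
qed

section \<open>The sum \<open>R\<close> and shapes with equal first two columns\<close>

text \<open>The index \<open>i\<close> of \<open>r_num\<close> encodes the shape \<open>(a, a, c)\<close> with \<open>a - c = i - 1\<close>; the range
  \<open>i \<le> n div 2\<close> excludes precisely the two-column shape \<open>c = 0\<close>.\<close>

lemma R_sum_eq_sum:
  "R_sum (Suc n) = sum num3 {(a, b, c) \<in> shapes3 n. a = b \<and> c \<noteq> 0}"
proof -
  let ?I = "{i \<in> {0..Suc n div 2}. [int (Suc n) - 2 * int i = 2] (mod 3) \<and> i \<noteq> 0}"
  \<comment> \<open>At index 0 the third column would be one cell longer than the second, so the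
    list is no shape.\<close>
  have "r_num (Suc n) 0 = 0"
  proof (cases "(int n + 1) mod 3 = 2")
    case True
    then have "(int n - 1) div 3 < (int n + 2) div 3" by presburger
    then show ?thesis by (simp add: r_num_def syt_invalid valid_shape3 add.commute)
  qed (simp add: r_num_def cong_def add.commute)
  then have "R_sum (Suc n) = sum (r_num (Suc n)) ?I"
    unfolding R_sum_def
  proof (intro sum.mono_neutral_right ballI)
    fix i assume "i \<in> {0..Suc n div 2} - ?I"
    with \<open>r_num (Suc n) 0 = 0\<close> show "r_num (Suc n) i = 0"
      by (cases "i = 0") (auto simp: r_num_def)
  qed auto
  also have "\<dots> = sum num3 {(a, b, c) \<in> shapes3 n. a = b \<and> c \<noteq> 0}"
  proof (rule sum.reindex_bij_witness[where i = "\<lambda>(a, b, c). nat (a - c + 1)" and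
        j = "\<lambda>i. ((int (Suc n) + int i - 2) div 3, (int (Suc n) + int i - 2) div 3,
          (int (Suc n) - 2 * int i + 1) div 3)"])
    fix i assume "i \<in> ?I"
    then have i: "i \<noteq> 0" "i \<le> Suc n div 2" "(int (Suc n) - 2 * int i) mod 3 = 2"
      by (auto simp: cong_def)
    define c where "c = (int (Suc n) - 2 * int i + 1) div 3"
    \<comment> \<open>The congruence makes the divisions by 3 exact.\<close>
    have c: "int n = 3 * c + 2 * int i - 2"
      using i(3) unfolding c_def by presburger
    have a: "(int (Suc n) + int i - 2) div 3 = c + int i - 1"
      using c by simp
    \<comment> \<open>The bound \<open>2 * i \<le> n + 1\<close> gives \<open>3 * c \<ge> 1\<close>.
      Below, \<open>i \<noteq> 0\<close> yields \<open>c \<le> a\<close>, as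
      \<open>a = c + i - 1\<close>.\<close>
    have "c > 0"
      using c i by linarith
    then show "(case ((int (Suc n) + int i - 2) div 3, (int (Suc n) + int i - 2) div 3,
        (int (Suc n) - 2 * int i + 1) div 3) of (a, b, c) \<Rightarrow> nat (a - c + 1)) = i"
      and "((int (Suc n) + int i - 2) div 3, (int (Suc n) + int i - 2) div 3,
        (int (Suc n) - 2 * int i + 1) div 3) \<in> {(a, b, c) \<in> shapes3 n. a = b \<and> c \<noteq> 0}"
      unfolding a c_def[symmetric] using c i(1) by (auto simp: shapes3_def)
    show "num3 ((int (Suc n) + int i - 2) div 3, (int (Suc n) + int i - 2) div 3,
        (int (Suc n) - 2 * int i + 1) div 3) = r_num (Suc n) i"
      using i(3) by (simp add: r_num_def cong_def)
  next
    fix p assume "p \<in> {(a, b, c) \<in> shapes3 n. a = b \<and> c \<noteq> 0}"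
    then obtain a c where p: "p = (a, a, c)" "0 < c" "c \<le> a" "int n = 2 * a + c"
      by (auto simp: shapes3_def)
    have 1: "(int (Suc n) + (a - c + 1) - 2) div 3 = a" "(int (Suc n) - 2 * (a - c + 1) + 1) div 3 = c"
      using p by auto
    then show "((int (Suc n) + int (case p of (a, b, c) \<Rightarrow> nat (a - c + 1)) - 2) div 3,
        (int (Suc n) + int (case p of (a, b, c) \<Rightarrow> nat (a - c + 1)) - 2) div 3,
        (int (Suc n) - 2 * int (case p of (a, b, c) \<Rightarrow> nat (a - c + 1)) + 1) div 3) = p"
      using p by simp
    have "(int (Suc n) - 2 * (a - c + 1)) mod 3 = 2"
      using p by presburger
    moreover have "nat (a - c + 1) \<le> Suc n div 2"
      using p by linarith
    ultimately show "(case p of (a, b, c) \<Rightarrow> nat (a - c + 1)) \<in> ?I"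
      using p by (simp add: cong_def)
  qed
  finally show ?thesis .
qed

section \<open>Two-column shapes: ballot numbers and Catalan numbers\<close>

text \<open>Including the boundary case \<open>b = a + 1\<close>, where both sides vanish, makes the induction go through.\<close>

lemma num3_two_columns:
  "b \<le> Suc a \<Longrightarrow> int (num3 (int a, int b, 0))
    = int ((a + b) choose b) - (if b = 0 then 0 else int ((a + b) choose (b - 1)))"
proof (induction "a + b" arbitrary: a b)
  case 0
  have "diagram [0, 0, 0] = {}"
    by (auto simp: diagram_def nth_Cons' split: if_splits)
  then have "syt [0, 0, 0] = {Map.empty}"
    by (auto simp: syt_def valid_shape3)
  with 0 show ?case by simp
next
  case (Suc s)
  consider "b = Suc a" | "b = 0" | b' where "b = Suc b'" "b \<le> a"
    using Suc.prems by (metis le_SucE not0_implies_Suc)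
  then show ?case
  proof cases
    case 1
    then have "(a + b) choose b = (a + b) choose (b - 1)"
      using binomial_symmetric[of b "a + b"] by simp
    with 1 show ?thesis by (simp add: num3_invalid del: num3.simps)
  next
    case 2
    with Suc.hyps(2) obtain a' where a: "a = Suc a'" "s = a'" by auto
    with 2 num3_branching[of 0 0 "int a"] Suc.hyps(1)[of a' 0] show ?thesis
      by (simp add: num3_invalid del: num3.simps)
  next
    case 3
    then obtain a' where a: "a = Suc a'" by (cases a) auto
    have "num3 (int a, int b, 0) = num3 (int a', int b, 0) + num3 (int a, int b', 0)"
      using num3_branching[of 0 "int b" "int a"] 3 a by (simp add: num3_invalid del: num3.simps)
    \<comment> \<open>If \<open>b = a\<close>, this is the boundary case \<open>b = Suc a'\<close>
      of the induction hypothesis.\<close>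
    moreover have "int (num3 (int a', int b, 0)) = int ((a' + b) choose b) - int ((a' + b) choose b')"
      using Suc.hyps(1)[of a' b] Suc.hyps(2) 3 a by simp
    moreover have "int (num3 (int a, int b', 0))
        = int ((a + b') choose b') - (if b' = 0 then 0 else int ((a + b') choose (b' - 1)))"
      using Suc.hyps(1)[of a b'] Suc.hyps(2) 3 by simp
    \<comment> \<open>As \<open>a' + b = a + b'\<close>, Pascal's rule combines the binomials; for
      \<open>b' = 0\<close> the last one is absent.\<close>
    ultimately show ?thesis
      using 3(1) a by (cases b') (simp_all del: num3.simps)
  qed
qed

text \<open>The ballot number for equal columns is a difference of neighbouring central binomials,
  and the absorption identities turn it into the quotient form.\<close>

lemma catalan_eq_num3: "real (num3 (int m, int m, 0)) = catalan m"
proof (cases m)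
  case 0
  then show ?thesis
    using num3_two_columns[of 0 0] by (simp add: catalan_def del: num3.simps)
next
  case (Suc k)
  have "int (num3 (int m, int m, 0)) = int ((2 * m) choose m) - int ((2 * m) choose k)"
    using num3_two_columns[of m m] Suc by (simp add: mult_2 del: num3.simps)
  then have eq: "real (num3 (int m, int m, 0)) = real ((2 * m) choose m) - real ((2 * m) choose k)"
    by linarith
  \<comment> \<open>Both sides equal \<open>2 * m * ((2 * m - 1) choose k)\<close>. With
    \<open>m = Suc k\<close>, the factor \<open>2 * m - k\<close> is \<open>m + 1\<close>.\<close>
  have "Suc k * ((2 * m) choose Suc k) = (2 * m - k) * ((2 * m) choose k)"
    by (simp only: binomial_absorption binomial_absorb_comp)
  then have "m * ((2 * m) choose m) = (m + 1) * ((2 * m) choose k)"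
    using Suc by simp
  then have "real m * real ((2 * m) choose m) = (real m + 1) * real ((2 * m) choose k)"
    by (metis of_nat_mult of_nat_add of_nat_1)
  then show ?thesis
    unfolding eq catalan_def by (simp add: field_simps)
qed

text \<open>An empty third column forces \<open>n = 2 * a\<close>, so at most one such shape exists,
  and only for even \<open>n\<close>; the others form \<open>R\<close>.\<close>

lemma sum_num3_equal_columns:
  "real (sum num3 {(a, b, c) \<in> shapes3 n. a = b})
    = real (R_sum (Suc n)) + even_ind n * catalan (n div 2)"
proof -
  have fin: "finite {(a, b, c) \<in> shapes3 n. P a b c}" for P
    by (rule finite_subset[OF _ finite_shapes3[of n]]) auto
  have split: "{(a, b, c) \<in> shapes3 n. a = b}
      = {(a, b, c) \<in> shapes3 n. a = b \<and> c \<noteq> 0} \<union> {(a, b, c) \<in> shapes3 n. a = b \<and> c = 0}"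
    by auto
  have "{(a, b, c) \<in> shapes3 n. a = b \<and> c = 0}
      = (if even n then {(int (n div 2), int (n div 2), 0)} else {})"
    by (auto simp: shapes3_def) presburger+
  then have "real (sum num3 {(a, b, c) \<in> shapes3 n. a = b \<and> c = 0}) = even_ind n * catalan (n div 2)"
    by (simp add: even_ind_def catalan_eq_num3[symmetric] del: num3.simps)
  moreover have "sum num3 {(a, b, c) \<in> shapes3 n. a = b}
      = R_sum (Suc n) + sum num3 {(a, b, c) \<in> shapes3 n. a = b \<and> c = 0}"
    unfolding split R_sum_eq_sum by (intro sum.union_disjoint fin) auto
  ultimately show ?thesis by simp
qed

theorem theorem7:
  fixes n :: nat
  assumes "n \<ge> 3"
  shows "real (tau3 n) = 3 * real (tau3 (n - 1)) - real (R_sum n)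
           - even_ind (n - 1) * catalan ((n - 1) div 2) - real (beta (n - 1) 0)"
proof -
  from assms obtain m where n: "n = Suc m" by (cases n) auto
  have "real (tau3 (Suc m)) + real (sum num3 {(a, b, c) \<in> shapes3 m. a = b}) + real (beta m 0)
      = 3 * real (tau3 m)"
    using arg_cong[OF tau3_Suc[of m], of real] by (simp add: beta_0_eq_sum del: num3.simps)
  then show ?thesis
    unfolding n sum_num3_equal_columns by simp
qed

end
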